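(* Let $X,Y\in\mathcal L^\dagger(\mathcal D,\mathcal H)$. The following statements are equivalent: (i) $X\in L^{\rm s}(Y)$, i.e. the strong product $X\circ Y$ is well-defined; (ii) $X\in L^{\rm w}(Y)$, i.e. the weak product $X\,\Box\, Y$ is well-defined, and (ii$_1$) $\langle (X\,\Box\, Y)\xi\,|\,Z^\dagger\eta\rangle=\langle Y\xi\,|\,(X^\dagger\,\Box\, Z^\dagger)\eta\rangle$ for all $Z\in L^{\rm w}(X)$ and all $\xi,\eta\in\mathcal D$; (ii$_2$) $\langle (Y^\dagger\,\Box\, X^\dagger)\xi\,|\,V\eta\rangle=\langle X^\dagger\xi\,|\,(Y\,\Box\, V)\eta\rangle$ for all $V\in R^{\rm w}(Y)$ and all $\xi,\eta\in\mathcal D$.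
   Context: $\mathcal H$ is a complex Hilbert space with inner product $\langle\cdot|\cdot\rangle$ (linear in the first variable) and $\mathcal D$ is a dense subspace of $\mathcal H$. $\mathcal L^\dagger(\mathcal D,\mathcal H)$ is the set of all (closable) linear operators $X$ in $\mathcal H$ with domain $D(X)=\mathcal D$ and $D(X^* )\supseteq\mathcal D$, where $X^*$ is the Hilbert space adjoint; $X^\dagger:=X^*\upharpoonright\mathcal D$, and $\overline X$ is the closure of $X$. Weak multiplication: $X_1\,\Box\, X_2$ is well-defined (written $X_1\in L^{\rm w}(X_2)$, or $X_2\in R^{\rm w}(X_1)$) if $X_2\mathcal D\subset D((X_1^\dagger)^* )$ and $X_1^\dagger\mathcal D\subset D(X_2^* )$; then $X_1\,\Box\, X_2=(X_1^\dagger)^*X_2$. Equivalently, there is $Z\in\mathcal L^\dagger(\mathcal D,\mathcal H)$ with $\langle X_2\xi|X_1^\dagger\eta\rangle=\langle Z\xi|\eta\rangle$ for all $\xi,\eta\in\mathcal D$, and then $X_1\,\Box\, X_2=Z$. If $X_1\,\Box\,X_2$ is well-defined, so is $X_2^\dagger\,\Box\,X_1^\dagger=(X_1\,\Box\,X_2)^\dagger$. Strong multiplication: $X\circ Y$ is well-defined (written $X\in L^{\rm s}(Y)$, or $Y\in R^{\rm s}(X)$) if $Y\mathcal D\subset D(\overline X)$ and $X^\dagger\mathcal D\subset D(\overline{Y^\dagger})$; then $(X\circ Y)\xi=\overline X(Y\xi)$ for $\xi\in\mathcal D$. *)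

theory Defs
  imports "HOL-Analysis.Analysis"
begin

section \<open>Complex Hilbert spaces\<close>

text \<open>
  The inner product is linear in the first variable. The topology is that of the norm of the
  superclass, which is tied to the inner product by \<open>norm_eq_sqrt_cinner\<close>.
\<close>

class complex_inner = real_normed_vector +
  fixes scaleC :: "complex \<Rightarrow> 'a \<Rightarrow> 'a"  (infixr "*\<^sub>C" 75)
    and cinner :: "'a \<Rightarrow> 'a \<Rightarrow> complex"  ("\<langle>_ | _\<rangle>")
  assumes scaleC_add_right: "a *\<^sub>C (x + y) = a *\<^sub>C x + a *\<^sub>C y"
    and scaleC_add_left: "(a + b) *\<^sub>C x = a *\<^sub>C x + b *\<^sub>C x"
    and scaleC_scaleC: "a *\<^sub>C (b *\<^sub>C x) = (a * b) *\<^sub>C x"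
    and scaleC_one: "1 *\<^sub>C x = x"
    and scaleR_eq_scaleC: "r *\<^sub>R x = complex_of_real r *\<^sub>C x"
    and cinner_add_left: "\<langle>x + y | z\<rangle> = \<langle>x | z\<rangle> + \<langle>y | z\<rangle>"
    and cinner_scaleC_left: "\<langle>a *\<^sub>C x | y\<rangle> = a * \<langle>x | y\<rangle>"
    and cinner_commute: "\<langle>x | y\<rangle> = cnj \<langle>y | x\<rangle>"
    and cinner_self_nonneg: "0 \<le> Re \<langle>x | x\<rangle>"
    and cinner_self_eq_0_iff: "\<langle>x | x\<rangle> = 0 \<longleftrightarrow> x = 0"
    and norm_eq_sqrt_cinner: "norm x = sqrt (Re \<langle>x | x\<rangle>)"

class chilbert_space = complex_inner + complete_space

global_interpretation complex_vector:
  vector_space "scaleC :: complex \<Rightarrow> 'a \<Rightarrow> 'a::complex_inner"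
  defines csubspace = complex_vector.subspace
  by standard (simp_all add: scaleC_add_right scaleC_add_left scaleC_scaleC scaleC_one)


section \<open>Operators with domain\<close>

text \<open>
  An operator \<open>A\<close> in a space \<open>'h\<close> is a partial function \<open>A :: 'h \<rightharpoonup> 'h\<close>: its domain is \<open>dom A\<close>,
  its range \<open>ran A\<close> and its graph \<open>Map.graph A\<close>. Equality of operators thus includes equality of
  domains. \<open>A \<cdot> x\<close> is meaningful only for \<open>x \<in> dom A\<close>.
\<close>

abbreviation op_apply :: "('h \<rightharpoonup> 'h) \<Rightarrow> 'h \<Rightarrow> 'h"  (infixr "\<cdot>" 80)
  where "A \<cdot> x \<equiv> the (A x)"

definition linear_operator :: "('h::complex_inner \<rightharpoonup> 'h) \<Rightarrow> bool" where
  "linear_operator A \<longleftrightarrow> csubspace (dom A) \<and>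
     (\<forall>x\<in>dom A. \<forall>y\<in>dom A. A \<cdot> (x + y) = A \<cdot> x + A \<cdot> y) \<and>
     (\<forall>c. \<forall>x\<in>dom A. A \<cdot> (c *\<^sub>C x) = c *\<^sub>C (A \<cdot> x))"

definition adjoint_rel :: "('h::complex_inner \<rightharpoonup> 'h) \<Rightarrow> 'h \<Rightarrow> 'h \<Rightarrow> bool" where
  "adjoint_rel A \<eta> \<zeta> \<longleftrightarrow> (\<forall>\<xi>\<in>dom A. \<langle>A \<cdot> \<xi> | \<eta>\<rangle> = \<langle>\<xi> | \<zeta>\<rangle>)"

text \<open>
  The Hilbert space adjoint \<open>A\<^sup>*\<close>. It is intended for densely defined \<open>A\<close>, where the vector \<open>\<zeta>\<close> is
  unique (\<open>adjoint_rel_unique\<close> below).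
\<close>

definition op_adjoint :: "('h::complex_inner \<rightharpoonup> 'h) \<Rightarrow> ('h \<rightharpoonup> 'h)" where
  "op_adjoint A = (\<lambda>\<eta>. if \<exists>\<zeta>. adjoint_rel A \<eta> \<zeta> then Some (THE \<zeta>. adjoint_rel A \<eta> \<zeta>) else None)"

definition closable :: "('h::complex_inner \<rightharpoonup> 'h) \<Rightarrow> bool" where
  "closable A \<longleftrightarrow> single_valued (closure (Map.graph A))"

text \<open>
  The closure of a closable operator, i.e. the operator whose graph is the closure of the graph of
  \<open>A\<close> (\<open>graph_op_closure\<close> below).
\<close>

definition op_closure :: "('h::complex_inner \<rightharpoonup> 'h) \<Rightarrow> ('h \<rightharpoonup> 'h)" where
  "op_closure A = (\<lambda>x. if x \<in> Domain (closure (Map.graph A))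
                        then Some (THE y. (x, y) \<in> closure (Map.graph A)) else None)"


section \<open>The space \<open>\<L>\<^sup>\<dagger>(\<D>,\<H>)\<close> and its partial multiplications\<close>

text \<open>
  Members are automatically closable when \<open>D\<close> is dense: \<open>L_dagger_closable\<close> below.
\<close>

definition L_dagger :: "'h::complex_inner set \<Rightarrow> ('h \<rightharpoonup> 'h) set" where
  "L_dagger D = {X. linear_operator X \<and> dom X = D \<and> D \<subseteq> dom (op_adjoint X)}"

definition dagger :: "('h::complex_inner \<rightharpoonup> 'h) \<Rightarrow> ('h \<rightharpoonup> 'h)"  ("_\<^sup>\<dagger>" [1000] 1000) where
  "X\<^sup>\<dagger> = op_adjoint X |` dom X"

definition weak_prod_defined :: "('h::complex_inner \<rightharpoonup> 'h) \<Rightarrow> ('h \<rightharpoonup> 'h) \<Rightarrow> bool" where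
  "weak_prod_defined X\<^sub>1 X\<^sub>2 \<longleftrightarrow>
     ran X\<^sub>2 \<subseteq> dom (op_adjoint (X\<^sub>1\<^sup>\<dagger>)) \<and> ran (X\<^sub>1\<^sup>\<dagger>) \<subseteq> dom (op_adjoint X\<^sub>2)"

definition weak_prod :: "('h::complex_inner \<rightharpoonup> 'h) \<Rightarrow> ('h \<rightharpoonup> 'h) \<Rightarrow> ('h \<rightharpoonup> 'h)"
    (infixl "\<box>" 70) where
  "X\<^sub>1 \<box> X\<^sub>2 = op_adjoint (X\<^sub>1\<^sup>\<dagger>) \<circ>\<^sub>m X\<^sub>2"

definition weak_left :: "'h::complex_inner set \<Rightarrow> ('h \<rightharpoonup> 'h) \<Rightarrow> ('h \<rightharpoonup> 'h) set"  ("L\<^sup>w") where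
  "L\<^sup>w D X\<^sub>2 = {X\<^sub>1 \<in> L_dagger D. weak_prod_defined X\<^sub>1 X\<^sub>2}"

definition weak_right :: "'h::complex_inner set \<Rightarrow> ('h \<rightharpoonup> 'h) \<Rightarrow> ('h \<rightharpoonup> 'h) set"  ("R\<^sup>w") where
  "R\<^sup>w D X\<^sub>1 = {X\<^sub>2 \<in> L_dagger D. weak_prod_defined X\<^sub>1 X\<^sub>2}"

definition strong_prod_defined :: "('h::complex_inner \<rightharpoonup> 'h) \<Rightarrow> ('h \<rightharpoonup> 'h) \<Rightarrow> bool" where
  "strong_prod_defined X Y \<longleftrightarrow>
     ran Y \<subseteq> dom (op_closure X) \<and> ran (X\<^sup>\<dagger>) \<subseteq> dom (op_closure (Y\<^sup>\<dagger>))"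

definition strong_left :: "'h::complex_inner set \<Rightarrow> ('h \<rightharpoonup> 'h) \<Rightarrow> ('h \<rightharpoonup> 'h) set"  ("L\<^sup>s") where
  "L\<^sup>s D Y = {X \<in> L_dagger D. strong_prod_defined X Y}"


section \<open>Well-definedness of the adjoint and the closure\<close>

lemma cinner_add_right: "\<langle>x | y + z\<rangle> = \<langle>x | y\<rangle> + \<langle>x | z\<rangle>" for x :: "'h::complex_inner"
  by (metis cinner_add_left cinner_commute complex_cnj_add)

lemma cinner_scaleC_right: "\<langle>x | a *\<^sub>C y\<rangle> = cnj a * \<langle>x | y\<rangle>" for x :: "'h::complex_inner"
  by (metis cinner_commute cinner_scaleC_left complex_cnj_mult)

lemma cinner_diff_left: "\<langle>x - y | z\<rangle> = \<langle>x | z\<rangle> - \<langle>y | z\<rangle>" for x :: "'h::complex_inner"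
  using cinner_add_left[of "x - y" y z] by simp

lemma cinner_diff_right: "\<langle>x | y - z\<rangle> = \<langle>x | y\<rangle> - \<langle>x | z\<rangle>" for x :: "'h::complex_inner"
  using cinner_add_right[of x "y - z" z] by simp

lemma norm_scaleC: "norm (a *\<^sub>C x) = cmod a * norm x" for x :: "'h::complex_inner"
proof -
  have "\<langle>a *\<^sub>C x | a *\<^sub>C x\<rangle> = complex_of_real ((cmod a)\<^sup>2) * \<langle>x | x\<rangle>"
    by (simp only: cinner_scaleC_left cinner_scaleC_right complex_norm_square ac_simps)
  then show ?thesis
    by (simp add: norm_eq_sqrt_cinner real_sqrt_mult)
qed

lemma Re_cinner_polarization:
  "Re \<langle>x | y\<rangle> = ((norm (x + y))\<^sup>2 - (norm (x - y))\<^sup>2) / 4" for x :: "'h::complex_inner"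
proof -
  have "Re \<langle>y | x\<rangle> = Re \<langle>x | y\<rangle>"
    by (subst cinner_commute) simp
  moreover have "(norm z)\<^sup>2 = Re \<langle>z | z\<rangle>" for z :: 'h
    by (simp add: norm_eq_sqrt_cinner cinner_self_nonneg)
  ultimately show ?thesis
    by (simp add: cinner_add_left cinner_add_right cinner_diff_left cinner_diff_right)
qed

lemma Im_cinner: "Im \<langle>x | y\<rangle> = Re \<langle>x | \<i> *\<^sub>C y\<rangle>" for x :: "'h::complex_inner"
  by (simp add: cinner_scaleC_right)

lemma bounded_linear_scaleC: "bounded_linear (\<lambda>x :: 'h::complex_inner. a *\<^sub>C x)"
  by (rule bounded_linear_intro[where K = "cmod a"])
     (simp_all add: scaleC_add_right scaleR_eq_scaleC scaleC_scaleC norm_scaleC mult.commute)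

lemma continuous_on_cinner [continuous_intros]:
  fixes f g :: "'a::topological_space \<Rightarrow> 'h::complex_inner"
  assumes f: "continuous_on S f" and g: "continuous_on S g"
  shows "continuous_on S (\<lambda>x. \<langle>f x | g x\<rangle>)"
proof -
  have ig: "continuous_on S (\<lambda>x. \<i> *\<^sub>C g x)"
    by (rule bounded_linear.continuous_on[OF bounded_linear_scaleC g])
  have "continuous_on S (\<lambda>x. Complex (Re \<langle>f x | g x\<rangle>) (Im \<langle>f x | g x\<rangle>))"
    unfolding Im_cinner Re_cinner_polarization
    by (simp only: Complex_eq) (intro continuous_intros f g ig; simp)
  then show ?thesis by simp
qed

lemma cinner_eq_on_dense:
  fixes y z :: "'h::complex_inner"
  assumes "closure D = UNIV" and "\<And>\<xi>. \<xi> \<in> D \<Longrightarrow> \<langle>\<xi> | y\<rangle> = \<langle>\<xi> | z\<rangle>"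
  shows "y = z"
proof -
  have "closed {\<xi>. \<langle>\<xi> | y\<rangle> = \<langle>\<xi> | z\<rangle>}"
    by (intro closed_Collect_eq continuous_intros)
  moreover have "D \<subseteq> {\<xi>. \<langle>\<xi> | y\<rangle> = \<langle>\<xi> | z\<rangle>}"
    using assms(2) by auto
  ultimately have "\<langle>y - z | y\<rangle> = \<langle>y - z | z\<rangle>"
    using closure_minimal assms(1) by blast
  then have "\<langle>y - z | y - z\<rangle> = 0"
    by (simp add: cinner_diff_right)
  then show ?thesis
    by (simp add: cinner_self_eq_0_iff)
qed

lemma adjoint_rel_unique:
  assumes "closure (dom A) = UNIV" and "adjoint_rel A \<eta> \<zeta>" and "adjoint_rel A \<eta> \<zeta>'"
  shows "\<zeta> = \<zeta>'"
  using assms(2,3) by (intro cinner_eq_on_dense[OF assms(1)]) (simp add: adjoint_rel_def)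

lemma op_adjoint_eq_Some_iff:
  assumes "closure (dom A) = UNIV"
  shows "op_adjoint A \<eta> = Some \<zeta> \<longleftrightarrow> adjoint_rel A \<eta> \<zeta>"
  using adjoint_rel_unique[OF assms]
  by (auto simp: op_adjoint_def intro: theI the_equality)

lemma graph_op_closure:
  assumes "closable A"
  shows "Map.graph (op_closure A) = closure (Map.graph A)"
proof -
  have "op_closure A x = Some y \<longleftrightarrow> (x, y) \<in> closure (Map.graph A)" for x y
    using assms unfolding closable_def single_valued_def op_closure_def
    by (auto intro: theI the_equality)
  then show ?thesis
    by (auto simp: Map.graph_def)
qed

lemma L_dagger_closable:
  assumes "closure D = UNIV" and "X \<in> L_dagger D"
  shows "closable X"
  unfolding closable_def
proof (rule single_valuedI)
  have X: "dom X = D" "D \<subseteq> dom (op_adjoint X)"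
    using assms(2) by (auto simp: L_dagger_def)
  have *: "\<langle>\<eta> | y\<rangle> = \<langle>op_adjoint X \<cdot> \<eta> | x\<rangle>" if \<eta>: "\<eta> \<in> D" and xy: "(x, y) \<in> closure (Map.graph X)" for \<eta> x y
  proof -
    obtain \<zeta> where \<zeta>: "op_adjoint X \<eta> = Some \<zeta>"
      using X(2) \<eta> by blast
    then have rel: "adjoint_rel X \<eta> \<zeta>"
      using op_adjoint_eq_Some_iff X(1) assms(1) by blast
    let ?E = "{p. \<langle>snd p | \<eta>\<rangle> = \<langle>fst p | \<zeta>\<rangle>}"
    have "closed ?E"
      by (intro closed_Collect_eq continuous_intros)
    moreover have "Map.graph X \<subseteq> ?E"
      using rel by (force simp: adjoint_rel_def Map.graph_def)
    ultimately have "(x, y) \<in> ?E"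
      using closure_minimal xy by blast
    then show ?thesis
      using \<zeta> by simp (metis cinner_commute)
  qed
  fix x y z
  assume "(x, y) \<in> closure (Map.graph X)" "(x, z) \<in> closure (Map.graph X)"
  then show "y = z"
    using * by (intro cinner_eq_on_dense[OF assms(1)]) metis
qed

end

theory Submission
  imports Defs
begin

text \<open>
  A pair \<open>(y, w)\<close> lies in the closure of the graph of \<open>A\<close> iff it is orthogonal to the
  orthogonal complement of the graph, i.e. iff \<open>\<langle>w | b\<rangle> = \<langle>y | A\<^sup>* b\<rangle>\<close> for every \<open>b\<close> in the domain
  of \<open>A\<^sup>*\<close>. For \<open>w = (X\<^sup>\<dagger>)\<^sup>* y\<close> these conditions are obtained from (ii\<open>\<^sub>1\<close>) by taking for
  \<open>Z\<close> the rank one operator \<open>\<xi> \<mapsto> \<langle>\<xi> | b\<rangle> b\<close>, which is a left weak multiplier of \<open>X\<close> precisely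
  because \<open>b\<close> lies in the domain of \<open>X\<^sup>*\<close>. Condition (ii\<open>\<^sub>2\<close>) is (ii\<open>\<^sub>1\<close>) for the
  pair \<open>Y\<^sup>\<dagger>, X\<^sup>\<dagger>\<close>.
\<close>

section \<open>Orthogonality in Hilbert spaces\<close>

lemma cinner_zero_left [simp]: "\<langle>0 | x\<rangle> = 0" for x :: "'h::complex_inner"
  using cinner_diff_left[of 0 0 x] by simp

lemma cinner_zero_right [simp]: "\<langle>x | 0\<rangle> = 0" for x :: "'h::complex_inner"
  using cinner_diff_right[of x 0 0] by simp

lemma power2_norm_eq_cinner: "(norm x)\<^sup>2 = Re \<langle>x | x\<rangle>" for x :: "'h::complex_inner"
  by (simp add: norm_eq_sqrt_cinner cinner_self_nonneg)

lemma cinner_self: "\<langle>x | x\<rangle> = complex_of_real ((norm x)\<^sup>2)" for x :: "'h::complex_inner"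
proof -
  have "Im \<langle>x | x\<rangle> = 0"
    using arg_cong[OF cinner_commute[of x x], of Im] by simp
  then show ?thesis
    by (simp add: power2_norm_eq_cinner complex_eq_iff)
qed

section \<open>The projection theorem for closed subspaces\<close>

lemma parallelogram_law:
  "(norm (x + y))\<^sup>2 + (norm (x - y))\<^sup>2 = 2 * (norm x)\<^sup>2 + 2 * (norm y)\<^sup>2"
  for x :: "'h::complex_inner"
  unfolding power2_norm_eq_cinner
  by (simp add: cinner_add_left cinner_add_right cinner_diff_left cinner_diff_right)

text \<open>Removing from \<open>n\<close> its component along \<open>t\<close> lowers the squared
  norm by \<open>(cmod \<langle>n | t\<rangle>)\<^sup>2 / (norm t)\<^sup>2\<close>, which minimality
  forces to vanish.\<close>

lemma orthogonal_if_norm_minimal: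
  fixes n t :: "'h::complex_inner"
  assumes min: "\<And>c. norm n \<le> norm (n - c *\<^sub>C t)"
  shows "\<langle>t | n\<rangle> = 0"
proof (cases "t = 0")
  case False
  \<comment> \<open>The coefficient of the orthogonal projection of \<open>n\<close> onto the line
    of \<open>t\<close>.\<close>
  define c where "c = \<langle>n | t\<rangle> / complex_of_real ((norm t)\<^sup>2)"
  have nt: "cnj \<langle>n | t\<rangle> = \<langle>t | n\<rangle>"
    using cinner_commute[of t n] by simp
  have "\<langle>n - c *\<^sub>C t | n - c *\<^sub>C t\<rangle> = \<langle>n | n\<rangle> - \<langle>n | t\<rangle> * \<langle>t | n\<rangle> / complex_of_real ((norm t)\<^sup>2)"
    using False
    by (simp add: cinner_diff_left cinner_diff_right cinner_scaleC_left cinner_scaleC_right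
        c_def nt cinner_self[of t] field_simps)
  also have "\<langle>n | t\<rangle> * \<langle>t | n\<rangle> = complex_of_real ((cmod \<langle>n | t\<rangle>)\<^sup>2)"
    by (simp only: complex_norm_square nt)
  finally have "(norm (n - c *\<^sub>C t))\<^sup>2 = (norm n)\<^sup>2 - (cmod \<langle>n | t\<rangle>)\<^sup>2 / (norm t)\<^sup>2"
    unfolding power2_norm_eq_cinner[of "n - c *\<^sub>C t"] power2_norm_eq_cinner[of n]
    by (simp flip: of_real_divide of_real_power)
  moreover have "(norm n)\<^sup>2 \<le> (norm (n - c *\<^sub>C t))\<^sup>2"
    using min by (simp add: power_mono)
  ultimately have "(cmod \<langle>n | t\<rangle>)\<^sup>2 / (norm t)\<^sup>2 \<le> 0"
    by simp
  then have "\<langle>n | t\<rangle> = 0"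
    using False by (simp add: divide_le_0_iff)
  then show ?thesis
    using nt by simp
qed simp

text \<open>A minimizing sequence is Cauchy by the parallelogram law, since midpoints of points of
  \<open>S\<close> stay in \<open>S\<close>. Completeness gives its limit and closedness keeps the
  limit in \<open>S\<close>.\<close>

lemma ex_nearest_point:
  fixes S :: "'h::chilbert_space set"
  assumes S: "csubspace S" "closed S"
  obtains s where "s \<in> S" "\<And>t. t \<in> S \<Longrightarrow> norm (p - s) \<le> norm (p - t)"
proof -
  define I where "I = (INF s\<in>S. (norm (p - s))\<^sup>2)"
  have bdd: "bdd_below ((\<lambda>s. (norm (p - s))\<^sup>2) ` S)"
    by (rule bdd_belowI2[of _ 0]) simp
  have ne: "S \<noteq> {}"
    using S(1) complex_vector.subspace_0 by blast
  have I_le: "I \<le> (norm (p - s))\<^sup>2" if "s \<in> S" for s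
    unfolding I_def using bdd that by (rule cINF_lower)
  have "\<exists>s\<in>S. (norm (p - s))\<^sup>2 < I + inverse (real (Suc k))" for k
    using cINF_less_iff[OF ne bdd, of "I + inverse (real (Suc k))"] by (simp add: I_def)
  then obtain s where sS: "\<And>k. s k \<in> S"
    and s_lt: "\<And>k. (norm (p - s k))\<^sup>2 < I + inverse (real (Suc k))"
    by metis
  have diff: "(norm (s k - s m))\<^sup>2 \<le> 2 * inverse (real (Suc k)) + 2 * inverse (real (Suc m))" for k m
  proof -
    \<comment> \<open>The midpoint has squared distance at least \<open>I\<close> from
      \<open>p\<close>, so the sum term of the parallelogram law is at least \<open>4 * I\<close>.
      This cancels the two contributions \<open>2 * I\<close> coming from
      \<open>s_lt\<close>.\<close>
    have "(1/2) *\<^sub>R (s k + s m) \<in> S"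
      unfolding scaleR_eq_scaleC using S(1) sS
      by (intro complex_vector.subspace_scale complex_vector.subspace_add) auto
    then have "I \<le> (norm (p - (1/2) *\<^sub>R (s k + s m)))\<^sup>2"
      by (rule I_le)
    moreover have "(p - s k) + (p - s m) = 2 *\<^sub>R (p - (1/2) *\<^sub>R (s k + s m))"
      by (simp add: algebra_simps scaleR_2)
    then have "(norm ((p - s k) + (p - s m)))\<^sup>2 = 4 * (norm (p - (1/2) *\<^sub>R (s k + s m)))\<^sup>2"
      by (simp only: norm_scaleR power_mult_distrib) simp
    moreover have "norm ((p - s k) - (p - s m)) = norm (s k - s m)"
      by (simp add: norm_minus_commute)
    ultimately show ?thesis
      using parallelogram_law[of "p - s k" "p - s m"] s_lt[of k] s_lt[of m] by simp
  qed
  have "Cauchy s"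
  proof (rule metric_CauchyI)
    fix e :: real
    assume "e > 0"
    \<comment> \<open>With this bound each of the two terms in \<open>diff\<close> is below
      \<open>e\<^sup>2 / 2\<close> from \<open>N\<close> on.\<close>
    then obtain N where N: "inverse (real (Suc N)) < e\<^sup>2 / 4"
      using reals_Archimedean[of "e\<^sup>2 / 4"] by auto
    have "dist (s k) (s m) < e" if "k \<ge> N" "m \<ge> N" for k m
    proof -
      have "inverse (real (Suc k)) \<le> inverse (real (Suc N))"
        "inverse (real (Suc m)) \<le> inverse (real (Suc N))"
        using that by (simp_all add: field_simps)
      then have "(norm (s k - s m))\<^sup>2 < e\<^sup>2"
        using diff[of k m] N by linarith
      then show ?thesis
        using \<open>e > 0\<close> by (simp add: dist_norm power_less_imp_less_base)
    qed
    then show "\<exists>N. \<forall>k\<ge>N. \<forall>m\<ge>N. dist (s k) (s m) < e"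
      by blast
  qed
  then obtain l where l: "s \<longlonglongrightarrow> l"
    using Cauchy_convergent_iff convergent_def by blast
  have "(\<lambda>k. (norm (p - s k))\<^sup>2) \<longlonglongrightarrow> (norm (p - l))\<^sup>2"
    by (intro tendsto_intros l)
  moreover have "(\<lambda>k. I + inverse (real (Suc k))) \<longlonglongrightarrow> I + 0"
    by (intro tendsto_intros LIMSEQ_inverse_real_of_nat)
  ultimately have le: "(norm (p - l))\<^sup>2 \<le> I"
    using LIMSEQ_le[of _ "(norm (p - l))\<^sup>2" _ "I + 0"] less_imp_le[OF s_lt] by simp
  show ?thesis
  proof
    show "l \<in> S"
      using S(2) sS l closed_sequentially by blast
    show "norm (p - l) \<le> norm (p - t)" if "t \<in> S" for t
      using order_trans[OF le I_le[OF that]] by (rule power2_le_imp_le) simp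
  qed
qed

text \<open>If \<open>s\<close> is the point of \<open>S\<close> nearest to \<open>p\<close>, then
  \<open>p - s\<close> is orthogonal to \<open>S\<close>. The assumption for
  \<open>n = p - s\<close> makes it orthogonal to \<open>p\<close> too, hence to itself.\<close>

lemma mem_closed_subspace_if_orthogonal:
  fixes S :: "'h::chilbert_space set"
  assumes S: "csubspace S" "closed S"
    and orth: "\<And>n. (\<And>s. s \<in> S \<Longrightarrow> \<langle>s | n\<rangle> = 0) \<Longrightarrow> \<langle>p | n\<rangle> = 0"
  shows "p \<in> S"
proof -
  obtain s where s: "s \<in> S" "\<And>t. t \<in> S \<Longrightarrow> norm (p - s) \<le> norm (p - t)"
    using ex_nearest_point[OF S] by blast
  have perp: "\<langle>t | p - s\<rangle> = 0" if "t \<in> S" for t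
  proof (rule orthogonal_if_norm_minimal)
    fix c
    have "s + c *\<^sub>C t \<in> S"
      using S(1) s(1) that complex_vector.subspace_add complex_vector.subspace_scale by blast
    then show "norm (p - s) \<le> norm (p - s - c *\<^sub>C t)"
      using s(2) by (simp add: diff_diff_eq)
  qed
  then have "\<langle>p - s | p - s\<rangle> = 0"
    using orth[OF perp] perp[OF s(1)] by (simp add: cinner_diff_left)
  then show ?thesis
    using s(1) by (simp add: cinner_self_eq_0_iff)
qed

lemma csubspace_closure:
  fixes S :: "'h::complex_inner set"
  assumes "csubspace S"
  shows "csubspace (closure S)"
proof (rule complex_vector.subspaceI)
  show "0 \<in> closure S"
    using assms complex_vector.subspace_0 closure_subset by blast
next
  fix x y
  assume "x \<in> closure S" "y \<in> closure S"
  then obtain f g where f: "\<And>k. f k \<in> S" "f \<longlonglongrightarrow> x" and g: "\<And>k. g k \<in> S" "g \<longlonglongrightarrow> y"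
    unfolding closure_sequential by blast
  have "f k + g k \<in> S" for k
    using assms f(1) g(1) by (rule complex_vector.subspace_add)
  then show "x + y \<in> closure S"
    unfolding closure_sequential using tendsto_add[OF f(2) g(2)]
    by (intro exI[of _ "\<lambda>k. f k + g k"]) simp
next
  fix c x
  assume "x \<in> closure S"
  then obtain f where f: "\<And>k. f k \<in> S" "f \<longlonglongrightarrow> x"
    unfolding closure_sequential by blast
  have "c *\<^sub>C f k \<in> S" for k
    using assms f(1) by (rule complex_vector.subspace_scale)
  then show "c *\<^sub>C x \<in> closure S"
    unfolding closure_sequential using bounded_linear.tendsto[OF bounded_linear_scaleC f(2)]
    by (intro exI[of _ "\<lambda>k. c *\<^sub>C f k"]) simp
qed

text \<open>Graphs live in the product space, and the projection theorem is applied to them there.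
  The product norm of the library is the root of the sum of squares, so it is the norm of this inner
  product.\<close>

instantiation prod :: (complex_inner, complex_inner) complex_inner
begin

definition scaleC_prod_def: "c *\<^sub>C p = (c *\<^sub>C fst p, c *\<^sub>C snd p)"

definition cinner_prod_def: "\<langle>p | q\<rangle> = \<langle>fst p | fst q\<rangle> + \<langle>snd p | snd q\<rangle>"

instance
proof
  fix x y z :: "'a \<times> 'b" and a b :: complex and r :: real
  show "a *\<^sub>C (x + y) = a *\<^sub>C x + a *\<^sub>C y" "(a + b) *\<^sub>C x = a *\<^sub>C x + b *\<^sub>C x"
    "a *\<^sub>C b *\<^sub>C x = (a * b) *\<^sub>C x" "1 *\<^sub>C x = x"
    by (simp_all add: scaleC_prod_def scaleC_add_left scaleC_add_right scaleC_scaleC scaleC_one)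
  show "r *\<^sub>R x = complex_of_real r *\<^sub>C x"
    by (simp add: scaleC_prod_def scaleR_prod_def scaleR_eq_scaleC)
  show "\<langle>x + y | z\<rangle> = \<langle>x | z\<rangle> + \<langle>y | z\<rangle>" "\<langle>a *\<^sub>C x | y\<rangle> = a * \<langle>x | y\<rangle>"
    by (simp_all add: cinner_prod_def scaleC_prod_def cinner_add_left cinner_scaleC_left
        distrib_left)
  show "\<langle>x | y\<rangle> = cnj \<langle>y | x\<rangle>"
    unfolding cinner_prod_def complex_cnj_add by (simp only: flip: cinner_commute)
  have self: "\<langle>x | x\<rangle> = complex_of_real ((norm (fst x))\<^sup>2 + (norm (snd x))\<^sup>2)"
    by (simp add: cinner_prod_def cinner_self)
  show "0 \<le> Re \<langle>x | x\<rangle>"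
    by (simp add: self)
  show "\<langle>x | x\<rangle> = 0 \<longleftrightarrow> x = 0"
    unfolding self of_real_eq_0_iff sum_power2_eq_zero_iff by (simp add: prod_eq_iff)
  show "norm x = sqrt (Re \<langle>x | x\<rangle>)"
    by (simp add: self norm_prod_def)
qed

end

instance prod :: (chilbert_space, chilbert_space) chilbert_space ..


section \<open>Graphs of operators and their adjoints\<close>

lemma csubspace_graph:
  assumes "linear_operator A"
  shows "csubspace (Map.graph A)"
proof -
  have graph: "p \<in> Map.graph A \<longleftrightarrow> fst p \<in> dom A \<and> snd p = A \<cdot> fst p" for p
    by (force simp: Map.graph_def)
  have D: "csubspace (dom A)"
    and add: "\<And>x y. x \<in> dom A \<Longrightarrow> y \<in> dom A \<Longrightarrow> A \<cdot> (x + y) = A \<cdot> x + A \<cdot> y"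
    and scale: "\<And>c x. x \<in> dom A \<Longrightarrow> A \<cdot> (c *\<^sub>C x) = c *\<^sub>C (A \<cdot> x)"
    using assms by (auto simp: linear_operator_def)
  have zero: "0 \<in> dom A" "A \<cdot> 0 = 0"
    using complex_vector.subspace_0[OF D] add[of 0 0] by simp_all
  show ?thesis
    by (rule complex_vector.subspaceI)
      (simp_all add: graph zero add scale scaleC_prod_def complex_vector.subspace_add[OF D]
        complex_vector.subspace_scale[OF D] del: Product_Type.split_paired_All)
qed

text \<open>Orthogonality of \<open>n\<close> to all \<open>(x, A \<cdot> x)\<close> says precisely
  \<open>adjoint_rel A (snd n) (- fst n)\<close>. So the orthogonal complement of the graph is the
  rotated graph of the adjoint, and the closure of the graph is its double complement.\<close>

lemma mem_closure_graph_iff: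
  fixes A :: "'h::chilbert_space \<rightharpoonup> 'h"
  assumes "linear_operator A"
  shows "(y, w) \<in> closure (Map.graph A) \<longleftrightarrow>
    (\<forall>b a. adjoint_rel A b a \<longrightarrow> \<langle>w | b\<rangle> = \<langle>y | a\<rangle>)"
proof (intro iffI allI impI)
  fix b a
  assume yw: "(y, w) \<in> closure (Map.graph A)" and rel: "adjoint_rel A b a"
  let ?E = "{p. \<langle>snd p | b\<rangle> = \<langle>fst p | a\<rangle>}"
  have "closed ?E"
    by (intro closed_Collect_eq continuous_intros)
  moreover have "Map.graph A \<subseteq> ?E"
    using rel by (force simp: adjoint_rel_def Map.graph_def)
  ultimately have "(y, w) \<in> ?E"
    using closure_minimal yw by blast
  then show "\<langle>w | b\<rangle> = \<langle>y | a\<rangle>"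
    by simp
next
  assume *: "\<forall>b a. adjoint_rel A b a \<longrightarrow> \<langle>w | b\<rangle> = \<langle>y | a\<rangle>"
  show "(y, w) \<in> closure (Map.graph A)"
  proof (rule mem_closed_subspace_if_orthogonal)
    show "csubspace (closure (Map.graph A))"
      using assms by (intro csubspace_closure csubspace_graph)
  next
    fix n
    assume perp: "\<And>s. s \<in> closure (Map.graph A) \<Longrightarrow> \<langle>s | n\<rangle> = 0"
    have "\<langle>A \<cdot> x | snd n\<rangle> = \<langle>x | - fst n\<rangle>" if "x \<in> dom A" for x
    proof -
      have "(x, A \<cdot> x) \<in> closure (Map.graph A)"
        using that by (intro subsetD[OF closure_subset]) (auto simp: Map.graph_def)
      then show ?thesis
        using perp[of "(x, A \<cdot> x)"] cinner_diff_right[of x 0 "fst n"]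
        by (simp add: cinner_prod_def add_eq_0_iff)
    qed
    then have "\<langle>w | snd n\<rangle> = \<langle>y | - fst n\<rangle>"
      using * by (simp add: adjoint_rel_def)
    then show "\<langle>(y, w) | n\<rangle> = 0"
      using cinner_diff_right[of y 0 "fst n"] by (simp add: cinner_prod_def)
  qed simp
qed


section \<open>Daggers and weak products\<close>

lemma L_dagger_dom: "X \<in> L_dagger D \<Longrightarrow> dom X = D"
  by (simp add: L_dagger_def)

lemma L_dagger_linear: "X \<in> L_dagger D \<Longrightarrow> linear_operator X"
  by (simp add: L_dagger_def)

lemma op_adjoint_L_dagger_iff:
  assumes "closure D = UNIV" "X \<in> L_dagger D"
  shows "op_adjoint X \<eta> = Some \<zeta> \<longleftrightarrow> adjoint_rel X \<eta> \<zeta>"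
  using assms by (intro op_adjoint_eq_Some_iff) (simp add: L_dagger_dom)

lemma dom_dagger: "X \<in> L_dagger D \<Longrightarrow> dom (X\<^sup>\<dagger>) = D"
  by (auto simp: L_dagger_def dagger_def)

lemma dagger_eq_Some_iff:
  assumes "closure D = UNIV" "X \<in> L_dagger D"
  shows "X\<^sup>\<dagger> \<eta> = Some \<zeta> \<longleftrightarrow> \<eta> \<in> D \<and> adjoint_rel X \<eta> \<zeta>"
  using op_adjoint_L_dagger_iff[OF assms] L_dagger_dom[OF assms(2)]
  by (auto simp: dagger_def restrict_map_def)

lemma cinner_dagger:
  assumes "closure D = UNIV" "X \<in> L_dagger D" "\<xi> \<in> D" "\<eta> \<in> D"
  shows "\<langle>X \<cdot> \<xi> | \<eta>\<rangle> = \<langle>\<xi> | X\<^sup>\<dagger> \<cdot> \<eta>\<rangle>"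
proof -
  have "X\<^sup>\<dagger> \<eta> = Some (X\<^sup>\<dagger> \<cdot> \<eta>)"
    using dom_dagger[OF assms(2)] assms(4) by force
  then have "adjoint_rel X \<eta> (X\<^sup>\<dagger> \<cdot> \<eta>)"
    using dagger_eq_Some_iff[OF assms(1,2)] by blast
  then show ?thesis
    using assms(3) L_dagger_dom[OF assms(2)] by (simp add: adjoint_rel_def)
qed

lemma cinner_dagger':
  assumes "closure D = UNIV" "X \<in> L_dagger D" "\<xi> \<in> D" "\<eta> \<in> D"
  shows "\<langle>X\<^sup>\<dagger> \<cdot> \<xi> | \<eta>\<rangle> = \<langle>\<xi> | X \<cdot> \<eta>\<rangle>"
  using cinner_dagger[OF assms(1,2,4,3)] by (metis cinner_commute)

lemma adjoint_rel_dagger: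
  assumes "closure D = UNIV" "X \<in> L_dagger D" "\<eta> \<in> D"
  shows "adjoint_rel (X\<^sup>\<dagger>) \<eta> (X \<cdot> \<eta>)"
  using cinner_dagger'[OF assms(1,2) _ assms(3)] dom_dagger[OF assms(2)]
  by (simp add: adjoint_rel_def)

text \<open>Linearity is tested by inner products with the dense set \<open>D\<close>. The adjoint
  of \<open>X\<^sup>\<dagger>\<close> is defined on \<open>D\<close> because it extends
  \<open>X\<close>.\<close>

lemma dagger_L_dagger:
  assumes "closure D = UNIV" "X \<in> L_dagger D"
  shows "X\<^sup>\<dagger> \<in> L_dagger D"
proof -
  have D: "csubspace D"
    using assms(2) by (auto simp: L_dagger_def linear_operator_def)
  have "X\<^sup>\<dagger> \<cdot> (x + y) = X\<^sup>\<dagger> \<cdot> x + X\<^sup>\<dagger> \<cdot> y" if "x \<in> D" "y \<in> D" for x y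
    using that complex_vector.subspace_add[OF D]
    by (intro cinner_eq_on_dense[OF assms(1)])
      (simp add: cinner_add_right flip: cinner_dagger[OF assms])
  moreover have "X\<^sup>\<dagger> \<cdot> (c *\<^sub>C x) = c *\<^sub>C (X\<^sup>\<dagger> \<cdot> x)" if "x \<in> D" for x c
    using that complex_vector.subspace_scale[OF D]
    by (intro cinner_eq_on_dense[OF assms(1)])
      (simp add: cinner_scaleC_right flip: cinner_dagger[OF assms])
  moreover have "D \<subseteq> dom (op_adjoint (X\<^sup>\<dagger>))"
    using adjoint_rel_dagger[OF assms] by (auto simp: op_adjoint_def) blast
  ultimately show ?thesis
    using D dom_dagger[OF assms(2)] by (simp add: L_dagger_def linear_operator_def)
qed

lemma dagger_dagger:
  assumes "closure D = UNIV" "X \<in> L_dagger D"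
  shows "X\<^sup>\<dagger>\<^sup>\<dagger> = X"
proof
  fix \<eta>
  note X' = dagger_L_dagger[OF assms]
  show "X\<^sup>\<dagger>\<^sup>\<dagger> \<eta> = X \<eta>"
  proof (cases "\<eta> \<in> D")
    case True
    then have "X\<^sup>\<dagger>\<^sup>\<dagger> \<eta> = Some (X \<cdot> \<eta>)"
      using adjoint_rel_dagger[OF assms True] dagger_eq_Some_iff[OF assms(1) X'] by blast
    then show ?thesis
      using True L_dagger_dom[OF assms(2)] by force
  next
    case False
    then show ?thesis
      using dom_dagger[OF X'] L_dagger_dom[OF assms(2)] by (metis domIff)
  qed
qed

section \<open>The dagger exchanges left and right weak multipliers\<close>

lemma weak_prod_defined_dagger:
  assumes "closure D = UNIV" "X \<in> L_dagger D" "Y \<in> L_dagger D"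
  shows "weak_prod_defined (Y\<^sup>\<dagger>) (X\<^sup>\<dagger>) \<longleftrightarrow> weak_prod_defined X Y"
  using assms by (auto simp: weak_prod_defined_def dagger_dagger[where D = D])

lemma dagger_weak_left_iff:
  assumes "closure D = UNIV" "Y \<in> L_dagger D" "V \<in> L_dagger D"
  shows "V\<^sup>\<dagger> \<in> L\<^sup>w D (Y\<^sup>\<dagger>) \<longleftrightarrow> V \<in> R\<^sup>w D Y"
  using assms by (simp add: weak_left_def weak_right_def dagger_L_dagger
      weak_prod_defined_dagger[where D = D])

lemma weak_prod_apply:
  "\<xi> \<in> dom Y \<Longrightarrow> (X \<box> Y) \<cdot> \<xi> = op_adjoint (X\<^sup>\<dagger>) \<cdot> (Y \<cdot> \<xi>)"
  by (auto simp: weak_prod_def map_comp_def)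

text \<open>The dagger is an involution mapping the right multipliers of \<open>Y\<close> onto the
  left multipliers of \<open>Y\<^sup>\<dagger>\<close>. Used as a rewrite rule, this brings
  (ii\<open>\<^sub>2\<close>) into the form of (ii\<open>\<^sub>1\<close>).\<close>

lemma ball_weak_right_iff:
  assumes "closure D = UNIV" "Y \<in> L_dagger D"
  shows "(\<forall>V\<in>R\<^sup>w D Y. P V) \<longleftrightarrow> (\<forall>Z\<in>L\<^sup>w D (Y\<^sup>\<dagger>). P (Z\<^sup>\<dagger>))"
proof (intro iffI ballI)
  fix V
  assume V: "V \<in> R\<^sup>w D Y" and *: "\<forall>Z\<in>L\<^sup>w D (Y\<^sup>\<dagger>). P (Z\<^sup>\<dagger>)"
  then have "V \<in> L_dagger D"
    by (simp add: weak_right_def)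
  then show "P V"
    using V * dagger_weak_left_iff[OF assms] dagger_dagger[OF assms(1)] by metis
next
  fix Z
  assume Z: "Z \<in> L\<^sup>w D (Y\<^sup>\<dagger>)" and *: "\<forall>V\<in>R\<^sup>w D Y. P V"
  then have "Z \<in> L_dagger D"
    by (simp add: weak_left_def)
  then show "P (Z\<^sup>\<dagger>)"
    using Z * dagger_weak_left_iff[OF assms dagger_L_dagger[OF assms(1)]] dagger_dagger[OF assms(1)]
    by metis
qed


section \<open>Rank one multipliers\<close>

text \<open>For nonzero \<open>b\<close> this is \<open>(norm b)\<^sup>2\<close> times the
  orthogonal projection onto the line of \<open>b\<close>, restricted to \<open>D\<close>. It is
  symmetric, and its adjoint is defined everywhere.\<close>

definition rank_one :: "'h::complex_inner set \<Rightarrow> 'h \<Rightarrow> ('h \<rightharpoonup> 'h)" where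
  "rank_one D b = (\<lambda>\<xi>. Some (\<langle>\<xi> | b\<rangle> *\<^sub>C b)) |` D"

lemma dom_rank_one: "dom (rank_one D b) = D"
  by (simp add: rank_one_def)

lemma rank_one_apply: "\<xi> \<in> D \<Longrightarrow> rank_one D b \<cdot> \<xi> = \<langle>\<xi> | b\<rangle> *\<^sub>C b"
  by (simp add: rank_one_def)

lemma adjoint_rel_rank_one: "adjoint_rel (rank_one D b) \<eta> (\<langle>\<eta> | b\<rangle> *\<^sub>C b)"
  by (simp add: adjoint_rel_def dom_rank_one rank_one_apply cinner_scaleC_left cinner_scaleC_right
      flip: cinner_commute)

lemma dom_op_adjoint_rank_one: "dom (op_adjoint (rank_one D b)) = UNIV"
  using adjoint_rel_rank_one by (force simp: op_adjoint_def)

lemma rank_one_L_dagger: "csubspace D \<Longrightarrow> rank_one D b \<in> L_dagger D"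
  by (simp add: L_dagger_def linear_operator_def dom_rank_one dom_op_adjoint_rank_one
      rank_one_apply complex_vector.subspace_add complex_vector.subspace_scale
      cinner_add_left cinner_scaleC_left scaleC_add_left scaleC_scaleC)

lemma dagger_rank_one:
  assumes "csubspace D" "closure D = UNIV"
  shows "(rank_one D b)\<^sup>\<dagger> = rank_one D b"
proof
  fix \<eta>
  note Z = rank_one_L_dagger[OF assms(1), of b]
  show "(rank_one D b)\<^sup>\<dagger> \<eta> = rank_one D b \<eta>"
  proof (cases "\<eta> \<in> D")
    case True
    then show ?thesis
      using adjoint_rel_rank_one[of D b \<eta>] dagger_eq_Some_iff[OF assms(2) Z]
      by (simp add: rank_one_def)
  next
    case False
    then show ?thesis
      using dom_dagger[OF Z] dom_rank_one by (metis domIff)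
  qed
qed

lemma adjoint_rel_scaleC: "adjoint_rel A b a \<Longrightarrow> adjoint_rel A (c *\<^sub>C b) (c *\<^sub>C a)"
  by (simp add: adjoint_rel_def cinner_scaleC_right)

text \<open>The operator is its own dagger and its range lies in the line of \<open>b\<close>, hence
  in the domain of the adjoint of \<open>X\<close>. The other inclusion holds because its adjoint is
  everywhere defined.\<close>

lemma rank_one_weak_left:
  assumes D: "csubspace D" "closure D = UNIV" and X: "X \<in> L_dagger D" and rel: "adjoint_rel X b a"
  shows "rank_one D b \<in> L\<^sup>w D X"
proof -
  have "ran (rank_one D b) \<subseteq> dom (op_adjoint X)"
  proof
    fix z
    assume "z \<in> ran (rank_one D b)"
    then obtain c where "z = c *\<^sub>C b"
      by (auto simp: ran_def rank_one_def restrict_map_def split: if_splits)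
    then have "adjoint_rel X z (c *\<^sub>C a)"
      using adjoint_rel_scaleC[OF rel] by simp
    then show "z \<in> dom (op_adjoint X)"
      using op_adjoint_L_dagger_iff[OF D(2) X] by blast
  qed
  then show ?thesis
    by (simp add: weak_left_def weak_prod_defined_def rank_one_L_dagger[OF D(1)]
        dagger_rank_one[OF D] dom_op_adjoint_rank_one)
qed

text \<open>Since \<open>(X\<^sup>\<dagger> \<box> Z\<^sup>\<dagger>) \<cdot> \<eta>\<close> is the
  adjoint of \<open>X\<close> applied to \<open>Z\<^sup>\<dagger> \<cdot> \<eta>\<close>, the right
  side tests only vectors \<open>b\<close> of the form
  \<open>Z\<^sup>\<dagger> \<cdot> \<eta>\<close>. Rank one operators show that, up to scalars,
  every nonzero \<open>b\<close> in the domain of the adjoint has this form.\<close>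

lemma mem_closure_graph_iff_weak_left:
  fixes X :: "'h::chilbert_space \<rightharpoonup> 'h"
  assumes D: "csubspace D" "closure D = UNIV" and X: "X \<in> L_dagger D"
  shows "(y, w) \<in> closure (Map.graph X) \<longleftrightarrow>
    (\<forall>Z\<in>L\<^sup>w D X. \<forall>\<eta>\<in>D. \<langle>w | Z\<^sup>\<dagger> \<cdot> \<eta>\<rangle> = \<langle>y | (X\<^sup>\<dagger> \<box> Z\<^sup>\<dagger>) \<cdot> \<eta>\<rangle>)"
  unfolding mem_closure_graph_iff[OF L_dagger_linear[OF X]]
proof (intro iffI ballI allI impI)
  fix Z \<eta>
  assume *: "\<forall>b a. adjoint_rel X b a \<longrightarrow> \<langle>w | b\<rangle> = \<langle>y | a\<rangle>"
    and Z: "Z \<in> L\<^sup>w D X" and \<eta>: "\<eta> \<in> D"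
  have domZ: "dom (Z\<^sup>\<dagger>) = D"
    using Z by (intro dom_dagger) (simp add: weak_left_def)
  then have "Z\<^sup>\<dagger> \<cdot> \<eta> \<in> ran (Z\<^sup>\<dagger>)"
    using \<eta> by (force simp: ran_def)
  \<comment> \<open>This is the second inclusion in \<open>weak_prod_defined Z X\<close>.\<close>
  then have "Z\<^sup>\<dagger> \<cdot> \<eta> \<in> dom (op_adjoint X)"
    using Z by (auto simp: weak_left_def weak_prod_defined_def)
  then have "op_adjoint X (Z\<^sup>\<dagger> \<cdot> \<eta>) = Some (op_adjoint X \<cdot> (Z\<^sup>\<dagger> \<cdot> \<eta>))"
    by force
  then have "adjoint_rel X (Z\<^sup>\<dagger> \<cdot> \<eta>) (op_adjoint X \<cdot> (Z\<^sup>\<dagger> \<cdot> \<eta>))"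
    using op_adjoint_L_dagger_iff[OF D(2) X] by blast
  then show "\<langle>w | Z\<^sup>\<dagger> \<cdot> \<eta>\<rangle> = \<langle>y | (X\<^sup>\<dagger> \<box> Z\<^sup>\<dagger>) \<cdot> \<eta>\<rangle>"
    using * \<eta> domZ by (simp add: weak_prod_apply dagger_dagger[OF D(2) X])
next
  fix b a
  assume *: "\<forall>Z\<in>L\<^sup>w D X. \<forall>\<eta>\<in>D. \<langle>w | Z\<^sup>\<dagger> \<cdot> \<eta>\<rangle> = \<langle>y | (X\<^sup>\<dagger> \<box> Z\<^sup>\<dagger>) \<cdot> \<eta>\<rangle>" and rel: "adjoint_rel X b a"
  show "\<langle>w | b\<rangle> = \<langle>y | a\<rangle>"
  proof (cases "b = 0")
    case True
    \<comment> \<open>The rank one operator vanishes for \<open>b = 0\<close> and gives no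
      information; here uniqueness of the adjoint vector yields \<open>a = 0\<close>.\<close>
    have "adjoint_rel X 0 0"
      by (simp add: adjoint_rel_def)
    then have "a = 0"
      using rel True D(2) L_dagger_dom[OF X] by (metis adjoint_rel_unique)
    with True show ?thesis
      by simp
  next
    case False
    \<comment> \<open>Density of \<open>D\<close> provides a nonzero scalar
      \<open>\<langle>\<eta> | b\<rangle>\<close>. At this \<open>\<eta>\<close> both sides of the
      tested identity carry its conjugate as a factor, which is cancelled at the end.\<close>
    then obtain \<eta> where \<eta>: "\<eta> \<in> D" "\<langle>\<eta> | b\<rangle> \<noteq> 0"
      using cinner_eq_on_dense[OF D(2), of b 0] by auto
    have "op_adjoint X \<cdot> (\<langle>\<eta> | b\<rangle> *\<^sub>C b) = \<langle>\<eta> | b\<rangle> *\<^sub>C a"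
      using op_adjoint_L_dagger_iff[OF D(2) X] adjoint_rel_scaleC[OF rel, of "\<langle>\<eta> | b\<rangle>"]
      by (metis option.sel)
    then have "(X\<^sup>\<dagger> \<box> rank_one D b) \<cdot> \<eta> = \<langle>\<eta> | b\<rangle> *\<^sub>C a"
      using \<eta> by (simp add: weak_prod_apply dom_rank_one rank_one_apply dagger_dagger[OF D(2) X])
    moreover have "\<langle>w | rank_one D b \<cdot> \<eta>\<rangle> = \<langle>y | (X\<^sup>\<dagger> \<box> rank_one D b) \<cdot> \<eta>\<rangle>"
      using bspec[OF bspec[OF * rank_one_weak_left[OF D X rel]] \<eta>(1)]
      by (simp add: dagger_rank_one[OF D])
    ultimately show ?thesis
      using \<eta> by (simp add: rank_one_apply cinner_scaleC_right)
  qed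
qed


section \<open>Strong products\<close>

text \<open>The closure of \<open>X\<close> is a restriction of the adjoint of
  \<open>X\<^sup>\<dagger>\<close>: it suffices to use \<open>mem_closure_graph_iff\<close> with the
  pairs \<open>\<xi>\<close>, \<open>X\<^sup>\<dagger> \<cdot> \<xi>\<close> for
  \<open>\<xi>\<close> in \<open>D\<close>.\<close>

lemma mem_closure_graph_imp_adjoint_dagger:
  fixes X :: "'h::chilbert_space \<rightharpoonup> 'h"
  assumes D: "closure D = UNIV" and X: "X \<in> L_dagger D" and yw: "(y, w) \<in> closure (Map.graph X)"
  shows "op_adjoint (X\<^sup>\<dagger>) y = Some w"
proof -
  have "\<langle>X\<^sup>\<dagger> \<cdot> \<xi> | y\<rangle> = \<langle>\<xi> | w\<rangle>" if "\<xi> \<in> D" for \<xi>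
  proof -
    have "adjoint_rel X \<xi> (X\<^sup>\<dagger> \<cdot> \<xi>)"
      using that cinner_dagger[OF D X] L_dagger_dom[OF X] by (simp add: adjoint_rel_def)
    then have "\<langle>w | \<xi>\<rangle> = \<langle>y | X\<^sup>\<dagger> \<cdot> \<xi>\<rangle>"
      using yw mem_closure_graph_iff[OF L_dagger_linear[OF X]] by blast
    then show ?thesis
      by (metis cinner_commute)
  qed
  then show ?thesis
    using op_adjoint_L_dagger_iff[OF D dagger_L_dagger[OF D X]] dom_dagger[OF X]
    by (simp add: adjoint_rel_def)
qed

lemma dom_op_closure: "dom (op_closure A) = Domain (closure (Map.graph A))"
  by (auto simp: op_closure_def split: if_splits)

text \<open>The only candidate for the value of the closure at \<open>y\<close> is the value of the
  adjoint of \<open>X\<^sup>\<dagger>\<close>, so the existential over limits reduces to one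
  explicit pair.\<close>

lemma dom_op_closure_iff:
  fixes X :: "'h::chilbert_space \<rightharpoonup> 'h"
  assumes "closure D = UNIV" "X \<in> L_dagger D"
  shows "y \<in> dom (op_closure X) \<longleftrightarrow>
    y \<in> dom (op_adjoint (X\<^sup>\<dagger>)) \<and> (y, op_adjoint (X\<^sup>\<dagger>) \<cdot> y) \<in> closure (Map.graph X)"
proof
  assume "y \<in> dom (op_closure X)"
  then obtain w where w: "(y, w) \<in> closure (Map.graph X)"
    by (auto simp: dom_op_closure)
  then have "op_adjoint (X\<^sup>\<dagger>) y = Some w"
    by (rule mem_closure_graph_imp_adjoint_dagger[OF assms])
  with w show "y \<in> dom (op_adjoint (X\<^sup>\<dagger>)) \<and>
      (y, op_adjoint (X\<^sup>\<dagger>) \<cdot> y) \<in> closure (Map.graph X)"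
    by auto
next
  assume "y \<in> dom (op_adjoint (X\<^sup>\<dagger>)) \<and>
      (y, op_adjoint (X\<^sup>\<dagger>) \<cdot> y) \<in> closure (Map.graph X)"
  then show "y \<in> dom (op_closure X)"
    by (auto simp: dom_op_closure)
qed

text \<open>One half of strong multiplicability, obtained pointwise at
  \<open>y = Y \<cdot> \<xi>\<close>, where the candidate value is
  \<open>(X \<box> Y) \<cdot> \<xi>\<close>.\<close>

lemma ran_subset_dom_op_closure_iff:
  fixes X Y :: "'h::chilbert_space \<rightharpoonup> 'h"
  assumes D: "csubspace D" "closure D = UNIV" and X: "X \<in> L_dagger D" and Y: "Y \<in> L_dagger D"
  shows "ran Y \<subseteq> dom (op_closure X) \<longleftrightarrow>
    ran Y \<subseteq> dom (op_adjoint (X\<^sup>\<dagger>)) \<and>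
    (\<forall>Z\<in>L\<^sup>w D X. \<forall>\<xi>\<in>D. \<forall>\<eta>\<in>D.
       \<langle>(X \<box> Y) \<cdot> \<xi> | Z\<^sup>\<dagger> \<cdot> \<eta>\<rangle> = \<langle>Y \<cdot> \<xi> | (X\<^sup>\<dagger> \<box> Z\<^sup>\<dagger>) \<cdot> \<eta>\<rangle>)"
proof -
  have dom: "dom Y = D"
    using Y by (rule L_dagger_dom)
  then have ran: "ran Y \<subseteq> S \<longleftrightarrow> (\<forall>\<xi>\<in>D. Y \<cdot> \<xi> \<in> S)" for S
    by (force simp: ran_def)
  have "ran Y \<subseteq> dom (op_closure X) \<longleftrightarrow> (\<forall>\<xi>\<in>D. Y \<cdot> \<xi> \<in> dom (op_adjoint (X\<^sup>\<dagger>)) \<and>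
      (Y \<cdot> \<xi>, (X \<box> Y) \<cdot> \<xi>) \<in> closure (Map.graph X))"
    using dom by (simp only: ran dom_op_closure_iff[OF D(2) X] weak_prod_apply cong: ball_cong)
  then show ?thesis
    unfolding mem_closure_graph_iff_weak_left[OF D X] ran by blast
qed

theorem theorem3p5:
  fixes D :: "'h::chilbert_space set" and X Y :: "'h \<rightharpoonup> 'h"
  assumes "csubspace D" and "closure D = UNIV"
    and "X \<in> L_dagger D" and "Y \<in> L_dagger D"
  shows "X \<in> L\<^sup>s D Y \<longleftrightarrow>
    X \<in> L\<^sup>w D Y \<and>
    (\<forall>Z\<in>L\<^sup>w D X. \<forall>\<xi>\<in>D. \<forall>\<eta>\<in>D.
       \<langle>(X \<box> Y) \<cdot> \<xi> | Z\<^sup>\<dagger> \<cdot> \<eta>\<rangle> = \<langle>Y \<cdot> \<xi> | (X\<^sup>\<dagger> \<box> Z\<^sup>\<dagger>) \<cdot> \<eta>\<rangle>) \<and>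
    (\<forall>V\<in>R\<^sup>w D Y. \<forall>\<xi>\<in>D. \<forall>\<eta>\<in>D.
       \<langle>(Y\<^sup>\<dagger> \<box> X\<^sup>\<dagger>) \<cdot> \<xi> | V \<cdot> \<eta>\<rangle> = \<langle>X\<^sup>\<dagger> \<cdot> \<xi> | (Y \<box> V) \<cdot> \<eta>\<rangle>)"
proof -
  note D = assms(1,2) and X = assms(3) and Y = assms(4)
  note X' = dagger_L_dagger[OF D(2) X] and Y' = dagger_L_dagger[OF D(2) Y]
  have strong: "X \<in> L\<^sup>s D Y \<longleftrightarrow> ran Y \<subseteq> dom (op_closure X) \<and> ran (X\<^sup>\<dagger>) \<subseteq> dom (op_closure (Y\<^sup>\<dagger>))"
    using X by (simp add: strong_left_def strong_prod_defined_def)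
  have weak: "X \<in> L\<^sup>w D Y \<longleftrightarrow> ran Y \<subseteq> dom (op_adjoint (X\<^sup>\<dagger>)) \<and> ran (X\<^sup>\<dagger>) \<subseteq> dom (op_adjoint Y)"
    using X by (simp add: weak_left_def weak_prod_defined_def)
  \<comment> \<open>The first inclusion of \<open>strong\<close> is the half just treated for
    \<open>X\<close>, \<open>Y\<close>; the second is the same half for
    \<open>Y\<^sup>\<dagger>\<close>, \<open>X\<^sup>\<dagger>\<close>, with the double dagger of
    \<open>Y\<close> rewritten to \<open>Y\<close>.\<close>
  show ?thesis
    unfolding ball_weak_right_iff[OF D(2) Y] strong weak
      ran_subset_dom_op_closure_iff[OF D X Y] ran_subset_dom_op_closure_iff[OF D Y' X']
      dagger_dagger[OF D(2) Y]
    by blast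
qed

end
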